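(* Let $u^n$ be the solution of the single step time stepping scheme given by the four-stage Lobatto IIIC method with step size $\Delta t$, applied to $u'(t)+Au(t)=f(t)$, $0<t<T$, $u(0)=u^0$, and let $U_k^n$ be the solution obtained from the parareal algorithm with the backward Euler method (step size $\Delta T=J\Delta t$) as coarse propagator and this four-stage Lobatto IIIC scheme as fine propagator (all defined in the context). Then for all integers $J\ge2$ there holds $$\max_{1\le n\le N_c}\|U_k^n-u^{nJ}\|\le c\,\gamma^k\quad\text{with}\quad\gamma=0.31,$$ where $c$ denotes a constant.
   Context: $H$ is a Hilbert space with norm $\|\cdot\|$; $A$ is a positive definite, selfadjoint, linear operator with compact inverse, defined in $H$ with domain $D(A)$ dense in $H$; $T>0$; $u^0\in H$ is a given initial condition and $f:[0,T]\to H$ a given forcing term, with $f\in C([0,T];H)$ in the definition of the propagators below. Functions of $A$ such as $r(-\Delta t A)$ are defined by the spectral decomposition of $A$; $I$ is the identity. Four-stage Lobatto IIIC method ($m=4$): Runge–Kutta matrix $$M=\begin{pmatrix}\frac1{12}&-\frac{\sqrt5}{12}&\frac{\sqrt5}{12}&-\frac1{12}\\ \frac1{12}&\frac14&\frac{10-7\sqrt5}{60}&\frac{\sqrt5}{60}\\ \frac1{12}&\frac{10+7\sqrt5}{60}&\frac14&-\frac{\sqrt5}{60}\\ \frac1{12}&\frac5{12}&\frac5{12}&\frac1{12}\end{pmatrix},$$ weights $b=(\frac1{12},\frac5{12},\frac5{12},\frac1{12})^\top$, nodes $c_1=0$, $c_2=\frac12-\frac{\sqrt5}{10}$, $c_3=\frac12+\frac{\sqrt5}{10}$,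 $c_4=1$. Its rational functions are $r(z)=1+z\,b^\top(I-zM)^{-1}\mathbf 1$ with $\mathbf 1=(1,1,1,1)^\top$, and $(p_1(z),\dots,p_m(z))=b^\top(I-zM)^{-1}$. In particular $r(-s)=\frac{12s^2-120s+360}{s^4+12s^3+72s^2+240s+360}$. Grids: $\Delta t=T/N$, $t_n=n\Delta t$; $\Delta T=J\Delta t$, $N_c=T/\Delta T$ is assumed to be an integer (so $N=JN_c$), $T_n=n\Delta T$. Single step scheme: starting from the given $u^0$, $$u^{n+1}=r(-\Delta t A)u^n+\Delta t\sum_{i=1}^m p_i(-\Delta t A)f(t_n+c_i\Delta t),\qquad 0\le n\le N-1.$$ Coarse propagator (backward Euler): $\mathcal G(T_n,\Delta T,v,f)=(I+\Delta T A)^{-1}(v+\Delta T f(T_n))$. Fine propagator: $\mathcal F(t,\Delta t,v,f)=r(-\Delta tA)v+\Delta t\sum_{i=1}^m p_i(-\Delta tA)f(t+c_i\Delta t)$. Parareal algorithm: initialize $U_0^0=u^0$, $U_0^{n+1}=\mathcal G(T_n,\Delta T,U_0^n,f)$ for $n=0,\dots,N_c-1$. For $k=0,1,2,\dots$ (until a stopping criterion is met): (Step 1) for each $n=0,\dots,N_c-1$ set $\widetilde U^{n,0}=U_k^n$, $\widetilde U^{n,j+1}=\mathcal F(T_n+j\Delta t,\Delta t,\widetilde U^{n,j},f)$ for $j=0,\dots,J-1$, and $\widetilde U^{n+1}=\widetilde U^{n,J}$; (Step 2) set $U_{k+1}^0=u^0$ and $$U_{k+1}^{n+1}=\mathcal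 G(T_n,\Delta T,U_{k+1}^n,f)+\widetilde U^{n+1}-\mathcal G(T_n,\Delta T,U_k^n,f),\qquad n=0,\dots,N_c-1.$$ *)

theory Defs
  imports "HOL-Analysis.Analysis"
begin

text \<open>An unbounded operator is a domain \<open>D\<close> together with a function \<open>A\<close>, whose values outside
  \<open>D\<close> are irrelevant.\<close>

definition linear_operator :: "'h::real_vector set \<Rightarrow> ('h \<Rightarrow> 'h) \<Rightarrow> bool" where
  "linear_operator D A \<longleftrightarrow> subspace D \<and>
     (\<forall>x\<in>D. \<forall>y\<in>D. A (x + y) = A x + A y) \<and> (\<forall>x\<in>D. \<forall>a. A (a *\<^sub>R x) = a *\<^sub>R A x)"

definition adjoint_graph :: "'h::real_inner set \<Rightarrow> ('h \<Rightarrow> 'h) \<Rightarrow> ('h \<times> 'h) set" where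
  "adjoint_graph D A = {(y, z). \<forall>x\<in>D. A x \<bullet> y = x \<bullet> z}"

text \<open>Equality of the graphs, hence in particular of the domains; mere symmetry is weaker. This is
  used for densely defined \<open>A\<close>, where \<open>adjoint_graph\<close> is the graph of a function.\<close>

definition selfadjoint :: "'h::real_inner set \<Rightarrow> ('h \<Rightarrow> 'h) \<Rightarrow> bool" where
  "selfadjoint D A \<longleftrightarrow> adjoint_graph D A = {(x, A x) |x. x \<in> D}"

definition positive_definite :: "'h::real_inner set \<Rightarrow> ('h \<Rightarrow> 'h) \<Rightarrow> bool" where
  "positive_definite D A \<longleftrightarrow> (\<forall>x\<in>D. x \<noteq> 0 \<longrightarrow> A x \<bullet> x > 0)"

definition compact_inverse :: "'h::real_normed_vector set \<Rightarrow> ('h \<Rightarrow> 'h) \<Rightarrow> bool" where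
  "compact_inverse D A \<longleftrightarrow> bij_betw A D UNIV \<and>
     (\<forall>B. bounded B \<longrightarrow> compact (closure (inv_into D A ` B)))"

definition eigenspace :: "'h::real_vector set \<Rightarrow> ('h \<Rightarrow> 'h) \<Rightarrow> real \<Rightarrow> 'h set" where
  "eigenspace D A l = {v \<in> D. A v = l *\<^sub>R v}"

definition eigenvalues :: "'h::real_vector set \<Rightarrow> ('h \<Rightarrow> 'h) \<Rightarrow> real set" where
  "eigenvalues D A = {l. \<exists>v\<in>eigenspace D A l. v \<noteq> 0}"

definition orth_proj :: "'h::real_inner set \<Rightarrow> 'h \<Rightarrow> 'h" where
  "orth_proj S v = (THE p. p \<in> S \<and> (\<forall>w\<in>S. (v - p) \<bullet> w = 0))"

text \<open>\<open>\<phi>(A) v = \<Sum> \<phi>(\<lambda>) P\<^sub>\<lambda> v\<close>, the sum being over the distinct eigenvalues \<open>\<lambda>\<close> and \<open>P\<^sub>\<lambda>\<close> being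
  the orthogonal projection onto the eigenspace. As the spectrum of \<open>A\<close> is discrete, this is the
  spectral decomposition written without choosing an orthonormal basis of eigenvectors.\<close>

definition op_fun :: "'h::real_inner set \<Rightarrow> ('h \<Rightarrow> 'h) \<Rightarrow> (real \<Rightarrow> real) \<Rightarrow> 'h \<Rightarrow> 'h" where
  "op_fun D A \<phi> v = (\<Sum>\<^sub>\<infinity>l\<in>eigenvalues D A. \<phi> l *\<^sub>R orth_proj (eigenspace D A l) v)"

definition rk_r :: "real^'m^'m \<Rightarrow> real^'m \<Rightarrow> real \<Rightarrow> real" where
  "rk_r M b z = 1 + z * (b \<bullet> (matrix_inv (mat 1 - z *\<^sub>R M) *v 1))"

definition rk_p :: "real^'m^'m \<Rightarrow> real^'m \<Rightarrow> 'm \<Rightarrow> real \<Rightarrow> real" where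
  "rk_p M b i z = (b v* matrix_inv (mat 1 - z *\<^sub>R M)) $ i"

definition lobatto_M :: "real^4^4" where
  "lobatto_M = vector
     [vector [1/12, - sqrt 5 / 12,          sqrt 5 / 12,           - 1/12],
      vector [1/12, 1/4,                    (10 - 7 * sqrt 5) / 60, sqrt 5 / 60],
      vector [1/12, (10 + 7 * sqrt 5) / 60, 1/4,                    - sqrt 5 / 60],
      vector [1/12, 5/12,                   5/12,                   1/12]]"

definition lobatto_b :: "real^4" where
  "lobatto_b = vector [1/12, 5/12, 5/12, 1/12]"

definition lobatto_c :: "real^4" where
  "lobatto_c = vector [0, 1/2 - sqrt 5 / 10, 1/2 + sqrt 5 / 10, 1]"

abbreviation lobatto_r :: "real \<Rightarrow> real" where
  "lobatto_r \<equiv> rk_r lobatto_M lobatto_b"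

abbreviation lobatto_p :: "4 \<Rightarrow> real \<Rightarrow> real" where
  "lobatto_p \<equiv> rk_p lobatto_M lobatto_b"

definition coarse_prop ::
  "'h::real_inner set \<Rightarrow> ('h \<Rightarrow> 'h) \<Rightarrow> real \<Rightarrow> real \<Rightarrow> 'h \<Rightarrow> (real \<Rightarrow> 'h) \<Rightarrow> 'h" where
  "coarse_prop D A t dT v f = inv_into D (\<lambda>x. x + dT *\<^sub>R A x) (v + dT *\<^sub>R f t)"

definition fine_prop ::
  "'h::real_inner set \<Rightarrow> ('h \<Rightarrow> 'h) \<Rightarrow> real \<Rightarrow> real \<Rightarrow> 'h \<Rightarrow> (real \<Rightarrow> 'h) \<Rightarrow> 'h" where
  "fine_prop D A t dt v f =
     op_fun D A (\<lambda>l. lobatto_r (- dt * l)) v +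
     dt *\<^sub>R (\<Sum>i\<in>UNIV. op_fun D A (\<lambda>l. lobatto_p i (- dt * l)) (f (t + lobatto_c $ i * dt)))"

primrec single_step ::
  "'h::real_inner set \<Rightarrow> ('h \<Rightarrow> 'h) \<Rightarrow> (real \<Rightarrow> 'h) \<Rightarrow> 'h \<Rightarrow> real \<Rightarrow> nat \<Rightarrow> 'h" where
  "single_step D A f u0 dt 0 = u0"
| "single_step D A f u0 dt (Suc n) =
     op_fun D A (\<lambda>l. lobatto_r (- dt * l)) (single_step D A f u0 dt n) +
     dt *\<^sub>R (\<Sum>i\<in>UNIV. op_fun D A (\<lambda>l. lobatto_p i (- dt * l))
                          (f (real n * dt + lobatto_c $ i * dt)))"

text \<open>\<open>fine_sweep D A f t dt v j\<close> performs \<open>j\<close> fine steps from the value \<open>v\<close> at time \<open>t\<close>.\<close>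

primrec fine_sweep ::
  "'h::real_inner set \<Rightarrow> ('h \<Rightarrow> 'h) \<Rightarrow> (real \<Rightarrow> 'h) \<Rightarrow> real \<Rightarrow> real \<Rightarrow> 'h \<Rightarrow> nat \<Rightarrow> 'h" where
  "fine_sweep D A f t dt v 0 = v"
| "fine_sweep D A f t dt v (Suc j) =
     fine_prop D A (t + real j * dt) dt (fine_sweep D A f t dt v j) f"

text \<open>\<open>parareal D A f u0 dt J k n\<close> is the iterate \<open>U\<^sub>k\<^sup>n\<close>, with coarse step size \<open>J \<Delta>t\<close>.\<close>

fun parareal ::
  "'h::real_inner set \<Rightarrow> ('h \<Rightarrow> 'h) \<Rightarrow> (real \<Rightarrow> 'h) \<Rightarrow> 'h \<Rightarrow> real \<Rightarrow> nat \<Rightarrow> nat \<Rightarrow> nat \<Rightarrow> 'h" where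
  "parareal D A f u0 dt J k 0 = u0"
| "parareal D A f u0 dt J 0 (Suc n) =
     (let dT = real J * dt
      in coarse_prop D A (real n * dT) dT (parareal D A f u0 dt J 0 n) f)"
| "parareal D A f u0 dt J (Suc k) (Suc n) =
     (let dT = real J * dt; Tn = real n * dT
      in coarse_prop D A Tn dT (parareal D A f u0 dt J (Suc k) n) f
         + fine_sweep D A f Tn dt (parareal D A f u0 dt J k n) J
         - coarse_prop D A Tn dT (parareal D A f u0 dt J k n) f)"

end

theory Submission
  imports Defs
begin

text \<open>
  The error of the parareal iteration decouples in the spectral decomposition of \<open>A\<close>. On the
  eigenspace of \<open>\<lambda>\<close> the forcing terms cancel, and with \<open>s = \<Delta>t \<lambda>\<close>, \<open>g = 1 / (1 + J s)\<close> and
  \<open>R = r(-s)\<^sup>J\<close> the component \<open>e\<close> of the error satisfies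
  \<open>e\<^sub>k\<^sub>+\<^sub>1 (n + 1) = g e\<^sub>k\<^sub>+\<^sub>1 n + (R - g) e\<^sub>k n\<close>. As the error vanishes for \<open>n = 0\<close>, induction on \<open>n\<close>
  shows that an iteration shrinks \<open>max\<^sub>n \<bar>e\<^sub>k n\<bar>\<close> by the factor \<open>\<bar>R - g\<bar> / (1 - g)\<close>
  (\<open>parareal_mode_error\<close>).

  That this factor is at most 0.31 for all \<open>s > 0\<close> and \<open>J > 0\<close> (\<open>parareal_mode_contraction\<close>)
  follows from the two bounds \<open>exp (- s) \<le> r(-s) \<le> 1 / (1 + s)\<close>. By the upper one and Bernoulli's
  inequality, \<open>R \<le> g\<close>. By the lower one, \<open>R \<ge> exp (- x)\<close> for \<open>x = J s\<close>, and everything is reduced to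
  the inequality \<open>1 - 0.31 x \<le> exp (- x) (1 + x)\<close> in the single variable \<open>x \<ge> 0\<close>. The largest value of
  \<open>(1 - exp (- x) (1 + x)) / x\<close> is about 0.298, attained near \<open>x = 1.79\<close>.

  Since the maximum over \<open>n\<close> is taken separately on every eigenspace, passing back to the norm of
  the Hilbert space requires the maxima of the initial errors to be square summable over the modes,
  with a bound independent of \<open>J\<close> and of the number of coarse steps. They are dominated by a sum of
  norms of components of \<open>u\<^sup>0\<close> and of values of \<open>f\<close>, whose weights have a total bounded in
  terms of \<open>T\<close>; Minkowski's and Bessel's inequalities bound its \<open>\<ell>\<^sup>2\<close> norm by
  \<open>2 \<parallel>u\<^sup>0\<parallel> + 5 T max \<parallel>f\<parallel>\<close> (\<open>parareal_error_bound\<close>).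

  The coarse propagator is a resolvent whereas the fine one is an eigenfunction expansion. The two can
  be compared mode by mode because the eigenvectors of \<open>A\<close> are complete
  (\<open>eigenvectors_complete\<close>), the spectral theorem for the compact operator \<open>A\<^sup>-\<^sup>1\<close>.
\<close>

section \<open>The stability function of the Lobatto IIIC method\<close>

lemma vector_4:
  "(vector [a, b, c, d] :: 'a::zero^4) $ 1 = a" "(vector [a, b, c, d] :: 'a^4) $ 2 = b"
  "(vector [a, b, c, d] :: 'a^4) $ 3 = c" "(vector [a, b, c, d] :: 'a^4) $ 4 = d"
  unfolding vector_def by simp_all

lemma matrix_inv_right: "invertible X \<Longrightarrow> X ** matrix_inv X = mat 1"
  unfolding invertible_def matrix_inv_def by (metis (mono_tags, lifting) someI_ex)

text \<open>Algebraic stability of the method: with \<open>B = diag b\<close>, the matrix \<open>B M + M\<^sup>T B - b b\<^sup>T\<close> is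
  \<open>d d\<^sup>T / 144\<close> for \<open>d = (1, -\<surd>5, \<surd>5, -1)\<close>, hence positive semidefinite.\<close>

lemma lobatto_quadratic_form:
  "(\<Sum>i\<in>UNIV. lobatto_b $ i * x $ i * (lobatto_M *v x) $ i) =
     (lobatto_b \<bullet> x)\<^sup>2 / 2 + (x $ 1 - sqrt 5 * x $ 2 + sqrt 5 * x $ 3 - x $ 4)\<^sup>2 / 288"
proof -
  have "sqrt 5 * sqrt 5 = (5::real)" by simp
  then show ?thesis
    by (simp add: lobatto_M_def lobatto_b_def matrix_vector_mult_def inner_vec_def sum_4 vector_4
        field_simps power2_eq_square)
qed

text \<open>If \<open>(I + s M) x = 0\<close>, pairing with \<open>x\<close> in the inner product weighted by \<open>b\<close> gives
  \<open>\<Sum>b\<^sub>i x\<^sub>i\<^sup>2 \<le> 0\<close> by algebraic stability, so no determinant has to be computed.\<close>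

lemma lobatto_stage_matrix_invertible:
  assumes "s \<ge> 0"
  shows "invertible (mat 1 + s *\<^sub>R lobatto_M)"
proof -
  have "x = 0" if x: "(mat 1 + s *\<^sub>R lobatto_M) *v x = 0" for x
  proof -
    have "x + s *\<^sub>R (lobatto_M *v x) = 0"
      using x by (simp add: matrix_vector_mult_add_rdistrib scaleR_matrix_vector_assoc)
    then have "x $ i + s * (lobatto_M *v x) $ i = 0" for i
      by (simp add: vec_eq_iff)
    then have "0 = (\<Sum>i\<in>UNIV. lobatto_b $ i * x $ i * (x $ i + s * (lobatto_M *v x) $ i))"
      by simp
    also have "\<dots> = (\<Sum>i\<in>UNIV. lobatto_b $ i * (x $ i)\<^sup>2)
        + s * (\<Sum>i\<in>UNIV. lobatto_b $ i * x $ i * (lobatto_M *v x) $ i)"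
      by (simp add: sum_distrib_left sum.distrib[symmetric] algebra_simps power2_eq_square)
    also have "\<dots> \<ge> (\<Sum>i\<in>UNIV. lobatto_b $ i * (x $ i)\<^sup>2)"
      using assms by (simp add: lobatto_quadratic_form)
    finally have "(\<Sum>i\<in>UNIV. lobatto_b $ i * (x $ i)\<^sup>2) \<le> 0" .
    then have le: "(x $ 1)\<^sup>2 + 5 * (x $ 2)\<^sup>2 + 5 * (x $ 3)\<^sup>2 + (x $ 4)\<^sup>2 \<le> 0"
      by (simp add: lobatto_b_def sum_4 vector_4)
    have "(x $ 1)\<^sup>2 = 0" "(x $ 2)\<^sup>2 = 0" "(x $ 3)\<^sup>2 = 0" "(x $ 4)\<^sup>2 = 0"
      using le zero_le_power2[of "x $ 1"] zero_le_power2[of "x $ 2"] zero_le_power2[of "x $ 3"]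
        zero_le_power2[of "x $ 4"] by linarith+
    then show "x = 0" by (simp add: vec_eq_iff forall_4)
  qed
  then show ?thesis
    by (metis matrix_left_invertible_ker invertible_left_inverse)
qed

text \<open>This is \<open>360 det (I + s M)\<close>.\<close>

definition lobatto_denom :: "real \<Rightarrow> real" where
  "lobatto_denom s = s^4 + 12 * s^3 + 72 * s\<^sup>2 + 240 * s + 360"

lemma lobatto_denom_pos: "s \<ge> 0 \<Longrightarrow> lobatto_denom s > 0"
  by (simp add: lobatto_denom_def add_nonneg_pos)

text \<open>The numerators of the \<open>p\<^sub>i(-s)\<close> over the common denominator, obtained from Cramer's rule.\<close>

definition lobatto_p_num :: "real \<Rightarrow> real^4" where
  "lobatto_p_num s = vector
     [s\<^sup>2 - 10 * s + 30,
      5/2 * (1 - sqrt 5) * s\<^sup>2 + (25 - 15 * sqrt 5) * s + 150,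
      5/2 * (1 + sqrt 5) * s\<^sup>2 + (25 + 15 * sqrt 5) * s + 150,
      s^3 + 6 * s\<^sup>2 + 20 * s + 30]"

lemma lobatto_p_num_eq:
  "lobatto_p_num s v* (mat 1 + s *\<^sub>R lobatto_M) = lobatto_denom s *\<^sub>R lobatto_b"
proof -
  define w where "w = sqrt (5::real)"
  have w: "w * w = 5" "\<And>y. w * (w * y) = 5 * y" by (simp_all add: w_def)
  have "\<forall>j. (\<Sum>i\<in>UNIV. lobatto_p_num s $ i * (mat 1 + s *\<^sub>R lobatto_M) $ i $ j)
      = lobatto_denom s * lobatto_b $ j"
    unfolding forall_4 sum_4 lobatto_M_def lobatto_b_def lobatto_p_num_def lobatto_denom_def
      mat_def w_def[symmetric] vector_add_component vector_scaleR_component vec_lambda_beta vector_4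
    by (simp add: field_simps power2_eq_square power3_eq_cube power4_eq_xxxx w)
  then show ?thesis
    by (simp add: vec_eq_iff vector_matrix_mult_def mult.commute)
qed

lemma lobatto_p_row:
  assumes "s \<ge> 0"
  shows "lobatto_b v* matrix_inv (mat 1 - (- s) *\<^sub>R lobatto_M) =
    (1 / lobatto_denom s) *\<^sub>R lobatto_p_num s"
proof -
  define X where "X = mat 1 + s *\<^sub>R lobatto_M"
  have "((1 / lobatto_denom s) *\<^sub>R lobatto_p_num s) v* X = lobatto_b"
    using lobatto_denom_pos[OF assms]
    by (simp add: X_def scaleR_vector_matrix_assoc lobatto_p_num_eq)
  then have "lobatto_b v* matrix_inv X
      = ((1 / lobatto_denom s) *\<^sub>R lobatto_p_num s) v* (X ** matrix_inv X)"
    by (simp flip: vector_matrix_mul_assoc)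
  also have "\<dots> = (1 / lobatto_denom s) *\<^sub>R lobatto_p_num s"
    using lobatto_stage_matrix_invertible[OF assms] by (simp add: X_def matrix_inv_right)
  finally show ?thesis by (simp add: X_def)
qed

lemma lobatto_p_bounded:
  assumes "s \<ge> 0"
  shows "\<bar>lobatto_p i (- s)\<bar> \<le> 1"
proof -
  have "2.2 \<le> sqrt 5" by (rule real_le_rsqrt) (simp add: power2_eq_square)
  moreover have "sqrt 5 \<le> 2.3" by (rule real_le_lsqrt) (simp_all add: power2_eq_square)
  ultimately have bounds: "2.2 * s \<le> sqrt 5 * s" "sqrt 5 * s \<le> 2.3 * s"
      "2.2 * s\<^sup>2 \<le> sqrt 5 * s\<^sup>2" "sqrt 5 * s\<^sup>2 \<le> 2.3 * s\<^sup>2"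
    using assms by (intro mult_right_mono; simp)+
  have pos: "0 \<le> s" "0 \<le> s\<^sup>2" "0 \<le> s^3" "0 \<le> s^4"
    using assms by simp_all
  have "5/2 * (1 - sqrt 5) * s\<^sup>2 + (25 - 15 * sqrt 5) * s + 150
      = 5/2 * s\<^sup>2 - 5/2 * (sqrt 5 * s\<^sup>2) + 25 * s - 15 * (sqrt 5 * s) + 150"
    "5/2 * (1 + sqrt 5) * s\<^sup>2 + (25 + 15 * sqrt 5) * s + 150
      = 5/2 * s\<^sup>2 + 5/2 * (sqrt 5 * s\<^sup>2) + 25 * s + 15 * (sqrt 5 * s) + 150"
    by (simp_all add: field_simps)
  then have "\<forall>i. \<bar>lobatto_p_num s $ i\<bar> \<le> lobatto_denom s"
    unfolding forall_4 lobatto_p_num_def lobatto_denom_def vector_4 abs_le_iff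
    using bounds pos by (intro conjI) linarith+
  then have "\<bar>((1 / lobatto_denom s) *\<^sub>R lobatto_p_num s) $ i\<bar> \<le> 1"
    using lobatto_denom_pos[OF assms] by simp
  then show ?thesis
    by (simp only: rk_p_def lobatto_p_row[OF assms])
qed

lemma lobatto_r_eq:
  assumes "s \<ge> 0"
  shows "lobatto_r (- s) = (12 * s\<^sup>2 - 120 * s + 360) / lobatto_denom s"
proof -
  have "lobatto_r (- s) = 1 - s * ((lobatto_b v* matrix_inv (mat 1 - (- s) *\<^sub>R lobatto_M)) \<bullet> 1)"
    by (simp add: rk_r_def dot_lmul_matrix)
  also have "\<dots> = 1 - s * ((s^3 + 12 * s\<^sup>2 + 60 * s + 360) / lobatto_denom s)"
  proof -
    have "lobatto_p_num s \<bullet> 1 = s^3 + 12 * s\<^sup>2 + 60 * s + 360"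
      unfolding lobatto_p_num_def inner_vec_def sum_4 vector_4 by (simp add: field_simps)
    then show ?thesis by (simp only: lobatto_p_row[OF assms] inner_scaleR_left) simp
  qed
  also have "\<dots> = (12 * s\<^sup>2 - 120 * s + 360) / lobatto_denom s"
    using lobatto_denom_pos[OF assms]
    by (simp add: lobatto_denom_def field_simps power2_eq_square power3_eq_cube power4_eq_xxxx)
  finally show ?thesis .
qed

text \<open>After multiplying out, the terms of degree 0, 1 and 3 agree, and \<open>- 108 s\<^sup>2 \<le> s\<^sup>4 + 72 s\<^sup>2\<close> is left.\<close>

lemma lobatto_r_le:
  assumes "s \<ge> 0"
  shows "lobatto_r (- s) \<le> 1 / (1 + s)"
proof -
  have "(12 * s\<^sup>2 - 120 * s + 360) * (1 + s) \<le> lobatto_denom s"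
    using assms by (simp add: lobatto_denom_def algebra_simps power2_eq_square power3_eq_cube power4_eq_xxxx)
  then show ?thesis
    using lobatto_denom_pos[OF assms] assms by (simp add: lobatto_r_eq field_simps)
qed

text \<open>The rational function \<open>r\<close> is the Pade approximant of \<open>exp\<close> with numerator degree 2 and
  denominator degree 4. Its order 6 makes the derivative of \<open>exp s r(-s)\<close> equal to
  \<open>12 s\<^sup>6 exp s\<close> over the squared denominator, so this product increases from its value 1 at \<open>s = 0\<close>.\<close>

lemma lobatto_r_ge_exp:
  assumes "s \<ge> 0"
  shows "exp (- s) \<le> lobatto_r (- s)"
proof -
  define h where "h t = exp t * (12 * t\<^sup>2 - 120 * t + 360) / lobatto_denom t" for t :: real
  have "h 0 \<le> h s"
  proof (rule DERIV_nonneg_imp_nondecreasing[OF assms])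
    fix t :: real assume t: "0 \<le> t" "t \<le> s"
    have d: "lobatto_denom t \<noteq> 0" using lobatto_denom_pos[OF t(1)] by simp
    have N: "((\<lambda>t. exp t * (12 * t\<^sup>2 - 120 * t + 360)) has_real_derivative
        exp t * (12 * t\<^sup>2 - 96 * t + 240)) (at t)"
      by (auto intro!: derivative_eq_intros simp: algebra_simps)
    have Q: "(lobatto_denom has_real_derivative 4 * t^3 + 36 * t\<^sup>2 + 144 * t + 240) (at t)"
      unfolding lobatto_denom_def[abs_def] by (auto intro!: derivative_eq_intros)
    have "exp t * (12 * t\<^sup>2 - 96 * t + 240) * lobatto_denom t
        - exp t * (12 * t\<^sup>2 - 120 * t + 360) * (4 * t^3 + 36 * t\<^sup>2 + 144 * t + 240)
      = exp t * (12 * t^6)"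
      unfolding lobatto_denom_def by algebra
    then have "(h has_real_derivative
        exp t * (12 * t^6) / (lobatto_denom t * lobatto_denom t)) (at t)"
      unfolding h_def using DERIV_divide[OF N Q d] by simp
    moreover have "0 \<le> exp t * (12 * t^6) / (lobatto_denom t * lobatto_denom t)"
      using t(1) by simp
    ultimately show "\<exists>y. (h has_real_derivative y) (at t) \<and> 0 \<le> y" by blast
  qed
  moreover have "h 0 = 1" by (simp add: h_def lobatto_denom_def)
  ultimately show ?thesis
    by (simp add: h_def lobatto_r_eq[OF assms] exp_minus inverse_eq_divide divide_le_eq mult.commute)
qed

lemma exp_ge_cubic: "1 + y + y\<^sup>2 / 2 + y^3 / 6 \<le> exp y" for y :: real
proof -
  obtain t where "exp y = (\<Sum>m<4. y ^ m / fact m) + exp t / fact 4 * y ^ 4"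
    using Maclaurin_exp_le[of y 4] by blast
  moreover have "exp t / fact 4 * y ^ 4 \<ge> 0" by simp
  ultimately show ?thesis by (simp add: eval_nat_numeral)
qed

lemma exp_ge_quintic: "1 + y + y\<^sup>2 / 2 + y^3 / 6 + y^4 / 24 + y^5 / 120 \<le> exp y" for y :: real
proof -
  obtain t where "exp y = (\<Sum>m<6. y ^ m / fact m) + exp t / fact 6 * y ^ 6"
    using Maclaurin_exp_le[of y 6] by blast
  moreover have "exp t / fact 6 * y ^ 6 \<ge> 0" by simp
  ultimately show ?thesis by (simp add: eval_nat_numeral)
qed

text \<open>The right-hand side minus the left-hand side vanishes at 0 and is only about 0.02 at its local
  minimum near \<open>x = 1.7\<close>, so \<open>exp\<close> is bounded below by Taylor polynomials at two centres: at 0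
  for \<open>x \<le> 1\<close>, and at \<open>-2\<close> beyond, until the left-hand side is negative. Taylor polynomials of odd degree
  are lower bounds on the whole line, and they leave inequalities that completing a square decides.\<close>

lemma exp_times_one_plus_ge:
  fixes x :: real
  assumes "x \<ge> 0"
  shows "1 - 0.31 * x \<le> exp (- x) * (1 + x)"
proof -
  consider "x \<le> 1" | "1 \<le> x" "x \<le> 3.25" | "3.25 \<le> x" by linarith
  then show ?thesis
  proof cases
    case 1
    have "0 \<le> x * (0.31 - x / 2 + x\<^sup>2 / 3 - x^3 / 8 + x^4 / 30 - x^5 / 120)"
    proof (rule mult_nonneg_nonneg[OF assms])
      have "x^3 \<le> x\<^sup>2" "x^5 \<le> x^4"
        using assms 1 by (simp_all add: power_decreasing)
      \<comment> \<open>Replacing \<open>x\<^sup>3\<close> by \<open>x\<^sup>2\<close> and dropping the last two terms leaves a quadratic with its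
        minimum at \<open>6/5\<close>.\<close>
      moreover have "0 \<le> x\<^sup>2 - 12/5 * x + 36/25"
        using zero_le_power2[of "x - 6/5"] by (simp add: power2_eq_square algebra_simps)
      moreover have "0 \<le> x^4" by simp
      ultimately have "0 \<le> 31/100 - x / 2 + x\<^sup>2 / 3 - x^3 / 8 + x^4 / 30 - x^5 / 120"
        by linarith
      then show "0 \<le> 0.31 - x / 2 + x\<^sup>2 / 3 - x^3 / 8 + x^4 / 30 - x^5 / 120"
        by simp
    qed
    moreover have "(1 - x + x\<^sup>2 / 2 - x^3 / 6 + x^4 / 24 - x^5 / 120) * (1 + x)
        = 1 - 0.31 * x + x * (0.31 - x / 2 + x\<^sup>2 / 3 - x^3 / 8 + x^4 / 30 - x^5 / 120)"
      by (simp add: field_simps power_Suc[symmetric] del: power_Suc) (simp add: field_simps eval_nat_numeral)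
    ultimately have "1 - 0.31 * x \<le> (1 - x + x\<^sup>2 / 2 - x^3 / 6 + x^4 / 24 - x^5 / 120) * (1 + x)"
      by (simp only: le_add_same_cancel1)
    also have "\<dots> \<le> exp (- x) * (1 + x)"
      using exp_ge_quintic[of "- x"] assms by (intro mult_right_mono) simp_all
    finally show ?thesis .
  next
    case 2
    \<comment> \<open>The factor \<open>1 + x\<close> is \<open>3 - y\<close>, and in \<open>(1 + y + y\<^sup>2 / 2 + y\<^sup>3 / 6) (3 - y)\<close> the cubic term cancels.\<close>
    define y where "y = 2 - x"
    have y: "- (5/4) \<le> y" "y \<le> 1" and x: "x = 2 - y" using 2 by (simp_all add: y_def)
    have "\<bar>y\<bar> \<le> (5/4)" using y by linarith
    then have "y\<^sup>2 \<le> (5/4)\<^sup>2" by (metis abs_ge_zero power2_abs power_mono)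
    then have y4: "y^4 \<le> 25/16 * y\<^sup>2"
      using mult_right_mono[of "y\<^sup>2" "25/16" "y\<^sup>2"] by (simp add: power2_eq_square power4_eq_xxxx)
    \<comment> \<open>The bound \<open>e < 2.72\<close> is sharp enough; exactly, \<open>exp (- 2)\<close> is about 0.13534.\<close>
    have "exp (1::real) ^ 2 \<le> (272/100)\<^sup>2"
      using e_less_272 by (intro power_mono) simp_all
    then have "exp (2::real) \<le> 74/10" using exp_add[of 1 "1::real"] by (simp add: power2_eq_square)
    then have e2: "exp (- 2 :: real) \<ge> 1351/10000"
      by (simp add: exp_minus field_simps)
    have "0 \<le> (y - 3/5)\<^sup>2" "0 \<le> y\<^sup>2" by simp_all
    then have p: "38/100 + 31/100 * y \<le> 1351/10000 * (3 + 2 * y + y\<^sup>2 / 2 - y^4 / 6)"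
      using y4 y by (simp add: power2_eq_square algebra_simps)
    also have "0 \<le> 3 + 2 * y + y\<^sup>2 / 2 - y^4 / 6"
      using y4 y zero_le_power2[of y] by linarith
    then have "1351/10000 * (3 + 2 * y + y\<^sup>2 / 2 - y^4 / 6) \<le> exp (- 2) * (3 + 2 * y + y\<^sup>2 / 2 - y^4 / 6)"
      by (intro mult_right_mono e2)
    also have "\<dots> = exp (- 2) * ((1 + y + y\<^sup>2 / 2 + y^3 / 6) * (3 - y))"
      by (simp add: field_simps eval_nat_numeral)
    also have "\<dots> \<le> exp (- 2) * (exp y * (3 - y))"
      using y exp_ge_cubic[of y] by (intro mult_left_mono mult_right_mono) simp_all
    also have "\<dots> = exp (- x) * (1 + x)"
      by (simp add: x exp_diff exp_minus field_simps)
    finally have "38/100 + 31/100 * y \<le> exp (- x) * (1 + x)" .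
    moreover have "38/100 + 31/100 * y = 1 - 0.31 * x" by (simp add: x field_simps)
    ultimately show ?thesis by simp
  next
    case 3
    have "1 - 0.31 * x \<le> 0" using 3 by simp
    also have "0 \<le> exp (- x) * (1 + x)" using assms by simp
    finally show ?thesis .
  qed
qed

lemma lobatto_r_bounds:
  assumes "s \<ge> 0"
  shows "0 \<le> lobatto_r (- s)" "lobatto_r (- s) \<le> 1"
proof -
  show "0 \<le> lobatto_r (- s)"
    using lobatto_r_ge_exp[OF assms] by (meson exp_ge_zero order_trans)
  have "1 / (1 + s) \<le> 1" using assms by simp
  then show "lobatto_r (- s) \<le> 1"
    using lobatto_r_le[OF assms] by linarith
qed

text \<open>On an eigenspace, \<open>g\<close> is the coarse propagator and \<open>r(-s)\<^sup>J\<close> the fine one over a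
  coarse step. The upper bound on \<open>r\<close> makes their difference one-signed; the lower bound controls its size.\<close>

lemma parareal_mode_contraction:
  fixes s :: real and J :: nat
  assumes "s \<ge> 0"
  defines "g \<equiv> 1 / (1 + real J * s)"
  shows "\<bar>lobatto_r (- s) ^ J - g\<bar> \<le> 0.31 * (1 - g)"
proof -
  define x where "x = real J * s"
  have x: "x \<ge> 0" using assms by (simp add: x_def)
  have "lobatto_r (- s) ^ J \<le> (1 / (1 + s)) ^ J"
    using assms by (intro power_mono lobatto_r_le lobatto_r_bounds)
  also have "\<dots> = 1 / (1 + s) ^ J" by (simp add: power_one_over)
  also have "\<dots> \<le> g"
    unfolding g_def using assms Bernoulli_inequality[of s J] by (intro divide_left_mono) (simp_all add: add_pos_nonneg)
  finally have upper: "lobatto_r (- s) ^ J \<le> g" .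
  have "exp (- x) = exp (- s) ^ J"
    by (simp add: x_def exp_of_nat_mult[symmetric])
  also have "\<dots> \<le> lobatto_r (- s) ^ J"
    using assms by (intro power_mono lobatto_r_ge_exp) simp_all
  finally have "exp (- x) * (1 + x) \<le> lobatto_r (- s) ^ J * (1 + x)"
    using x by (intro mult_right_mono) simp_all
  then have "1 - 0.31 * x \<le> lobatto_r (- s) ^ J * (1 + x)"
    using exp_times_one_plus_ge[OF x] by linarith
  then have "(1 - 0.31 * x) / (1 + x) \<le> lobatto_r (- s) ^ J"
    using x by (simp add: pos_divide_le_eq)
  moreover have "1 - g = x / (1 + x)"
    using x unfolding g_def x_def[symmetric] by (simp add: field_simps)
  then have "(1 - 0.31 * x) / (1 + x) = g - 0.31 * (1 - g)"
    unfolding g_def x_def[symmetric] by (simp add: diff_divide_distrib)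
  ultimately have "g - lobatto_r (- s) ^ J \<le> 0.31 * (1 - g)"
    by (simp only: diff_le_eq add.commute)
  moreover have "g \<le> 1" using x unfolding g_def x_def[symmetric] by simp
  ultimately show ?thesis using upper by simp
qed

section \<open>Orthogonal projections and orthogonal series\<close>

text \<open>Compactness yields a point \<open>p\<close> of \<open>S\<close> closest to \<open>v\<close>; the ball of radius \<open>\<parallel>v\<parallel>\<close> contains 0,
  so a closest point in it is closest in all of \<open>S\<close>. If \<open>v - p\<close> had a component
  along some \<open>w\<close> in \<open>S\<close>, moving \<open>p\<close> by it would come closer.\<close>

lemma exists_orth_proj_of_compact:
  fixes S :: "'h::real_inner set"
  assumes "subspace S" and cpt: "compact (S \<inter> cball v (norm v))"
  shows "\<exists>p\<in>S. \<forall>w\<in>S. (v - p) \<bullet> w = 0"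
proof -
  have "0 \<in> S \<inter> cball v (norm v)"
    using assms by (simp add: subspace_0 dist_norm)
  then obtain p where p: "p \<in> S" "dist v p \<le> norm v"
      and min: "\<And>y. y \<in> S \<Longrightarrow> dist v y \<le> norm v \<Longrightarrow> dist v p \<le> dist v y"
    using continuous_attains_inf[OF cpt, of "dist v"] continuous_on_dist[OF continuous_on_const continuous_on_id]
    by (metis IntE IntI empty_iff mem_cball)
  have min: "norm (v - p) \<le> norm (v - y)" if "y \<in> S" for y
    using min[OF that] p(2) by (cases "dist v y \<le> norm v") (simp_all add: dist_norm)
  have "(v - p) \<bullet> w = 0" if w: "w \<in> S" for w
  proof (cases "w = 0")
    case False
    define a where "a = ((v - p) \<bullet> w) / (w \<bullet> w)"
    have "p + a *\<^sub>R w \<in> S" using assms(1) p w by (simp add: subspace_add subspace_scale)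
    from min[OF this] have "(v - p) \<bullet> (v - p) \<le> (v - p - a *\<^sub>R w) \<bullet> (v - p - a *\<^sub>R w)"
      by (simp add: norm_le diff_diff_eq)
    also have "\<dots> = (v - p) \<bullet> (v - p) - 2 * a * ((v - p) \<bullet> w) + a * a * (w \<bullet> w)"
      by (simp add: inner_diff_left inner_diff_right inner_commute algebra_simps)
    also have "\<dots> = (v - p) \<bullet> (v - p) - ((v - p) \<bullet> w)\<^sup>2 / (w \<bullet> w)"
      using False by (simp add: a_def power2_eq_square)
    finally have "((v - p) \<bullet> w)\<^sup>2 / (w \<bullet> w) \<le> 0" by simp
    moreover have "w \<bullet> w > 0" using False by simp
    ultimately show ?thesis by (simp add: divide_le_0_iff)
  qed simp
  with p show ?thesis by blast
qed

lemma orth_proj_unique: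
  assumes "subspace S" "p \<in> S" "\<And>w. w \<in> S \<Longrightarrow> (v - p) \<bullet> w = 0"
  shows "orth_proj S v = p"
  unfolding orth_proj_def
proof (rule the_equality)
  fix q assume q: "q \<in> S \<and> (\<forall>w\<in>S. (v - q) \<bullet> w = 0)"
  then have "q - p \<in> S" using assms by (simp add: subspace_diff)
  then have "(v - p) \<bullet> (q - p) - (v - q) \<bullet> (q - p) = 0" using q assms by simp
  then have "(q - p) \<bullet> (q - p) = 0" by (simp add: inner_diff_left)
  then show "q = p" by simp
qed (use assms in blast)

text \<open>By Pythagoras, the norms of finite partial sums outside a large finite set are bounded by tails of
  the series of squared norms, so the net of partial sums is Cauchy.\<close>

lemma orthogonal_summable_on:
  fixes x :: "'i \<Rightarrow> 'h::{real_inner, complete_space}"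
  assumes orth: "pairwise (\<lambda>i j. orthogonal (x i) (x j)) I"
    and sq: "(\<lambda>i. (norm (x i))\<^sup>2) summable_on I"
  shows "x summable_on I"
proof -
  let ?q = "\<lambda>i. (norm (x i))\<^sup>2"
  have "\<exists>Q. eventually Q (finite_subsets_at_top I) \<and>
      (\<forall>F F'. Q F \<and> Q F' \<longrightarrow> dist (sum x F) (sum x F') < e)" if e: "e > 0" for e
  proof -
    have "(sum ?q \<longlongrightarrow> infsum ?q I) (finite_subsets_at_top I)"
      using has_sum_infsum[OF sq] by (simp add: has_sum_def)
    then have "\<forall>\<^sub>F F in finite_subsets_at_top I. infsum ?q I - (e / 2)\<^sup>2 < sum ?q F"
      by (rule order_tendstoD) (use e in simp)
    then obtain F0 where F0: "finite F0" "F0 \<subseteq> I"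
        and less: "infsum ?q I - (e / 2)\<^sup>2 < sum ?q F0"
      unfolding eventually_finite_subsets_at_top by blast
    define Q where "Q F \<longleftrightarrow> finite F \<and> F0 \<subseteq> F \<and> F \<subseteq> I" for F
    have close: "dist (sum x F) (sum x F0) < e / 2" if "Q F" for F
    proof -
      have F: "finite F" "F0 \<subseteq> F" "F \<subseteq> I" using that by (auto simp: Q_def)
      have "(norm (sum x (F - F0)))\<^sup>2 = sum ?q (F - F0)"
        using F by (intro norm_sum_Pythagorean pairwise_subset[OF orth]) auto
      also have "\<dots> = sum ?q F - sum ?q F0" using F by (simp add: sum_diff)
      also have "\<dots> < (e / 2)\<^sup>2"
        using less finite_sum_le_infsum[OF sq F(1,3)] by simp
      finally have "norm (sum x (F - F0)) < e / 2"
        by (rule power2_less_imp_less) (use e in simp)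
      moreover have "sum x (F - F0) = sum x F - sum x F0" using F by (intro sum_diff)
      ultimately show ?thesis by (simp add: dist_norm)
    qed
    have "dist (sum x F) (sum x F') < e" if "Q F" "Q F'" for F F'
      using dist_triangle2[of "sum x F" "sum x F'" "sum x F0"] close[OF that(1)] close[OF that(2)] by simp
    moreover have "eventually Q (finite_subsets_at_top I)"
      unfolding eventually_finite_subsets_at_top Q_def using F0 by blast
    ultimately show ?thesis by blast
  qed
  then have "cauchy_filter (filtermap (sum x) (finite_subsets_at_top I))"
    by (simp add: cauchy_filter_metric_filtermap)
  moreover have "complete (UNIV :: 'h set)"
    by (meson Cauchy_convergent UNIV_I complete_def convergent_def)
  ultimately obtain L where "(sum x \<longlongrightarrow> L) (finite_subsets_at_top I)"
    using complete_uniform[where S = UNIV] by (force simp add: filterlim_def)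
  then show ?thesis using summable_on_def has_sum_def by blast
qed

section \<open>The spectral decomposition\<close>

locale positive_operator_with_compact_inverse =
  fixes D :: "'h::{real_inner, complete_space} set" and A :: "'h \<Rightarrow> 'h"
  assumes lin: "linear_operator D A" and sa: "selfadjoint D A"
    and pd: "positive_definite D A" and ci: "compact_inverse D A"
begin

text \<open>Eigenvectors are found for this compact operator; unlike \<open>A\<close>, it can be applied to limits.\<close>

definition K :: "'h \<Rightarrow> 'h" where "K = inv_into D A"

lemma bij: "bij_betw A D UNIV" using ci by (simp add: compact_inverse_def)

lemma K_in: "K y \<in> D" and A_K: "A (K y) = y" and K_A: "x \<in> D \<Longrightarrow> K (A x) = x"
  using bij unfolding K_def
  by (metis UNIV_I bij_betw_imp_surj_on inv_into_into)
     (metis UNIV_I bij bij_betw_inv_into_right K_def,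
      metis bij bij_betw_inv_into_left K_def)

lemma subspace_D: "subspace D" using lin by (simp add: linear_operator_def)

lemma A_add: "x \<in> D \<Longrightarrow> y \<in> D \<Longrightarrow> A (x + y) = A x + A y"
  and A_scaleR: "x \<in> D \<Longrightarrow> A (a *\<^sub>R x) = a *\<^sub>R A x"
  using lin by (simp_all add: linear_operator_def)

lemma linear_K: "linear K"
proof
  show "K (x + y) = K x + K y" for x y
    using K_A[of "K x + K y"] by (simp add: K_in A_K A_add subspace_add[OF subspace_D])
  show "K (a *\<^sub>R x) = a *\<^sub>R K x" for a x
    using K_A[of "a *\<^sub>R K x"] by (simp add: K_in A_K A_scaleR subspace_scale[OF subspace_D])
qed

lemma A_symmetric: "x \<in> D \<Longrightarrow> y \<in> D \<Longrightarrow> A x \<bullet> y = x \<bullet> A y"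
  using sa unfolding selfadjoint_def adjoint_graph_def by blast

lemma K_symmetric: "K x \<bullet> y = x \<bullet> K y"
  using A_symmetric[OF K_in K_in, of x y] by (simp add: A_K)

lemma K_positive: "x \<noteq> 0 \<Longrightarrow> K x \<bullet> x > 0"
proof -
  assume "x \<noteq> 0"
  then have "K x \<noteq> 0" by (metis A_K A_scaleR K_in scaleR_zero_left)
  then show ?thesis
    using pd K_in[of x] by (metis A_K inner_commute positive_definite_def)
qed

lemma compact_K: "bounded B \<Longrightarrow> compact (closure (K ` B))"
  using ci by (simp add: compact_inverse_def K_def)

lemma bounded_linear_K: "bounded_linear K"
proof -
  have "bounded (K ` cball 0 1)"
    using compact_K[of "cball 0 1"] by (meson bounded_cball bounded_closure bounded_subset closure_subset compact_imp_bounded)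
  then obtain C where C: "\<And>x. norm x \<le> 1 \<Longrightarrow> norm (K x) \<le> C"
    unfolding bounded_iff by (metis image_eqI mem_cball_0)
  have "norm (K x) \<le> norm x * C" for x
  proof (cases "x = 0")
    case True then show ?thesis by (simp add: linear_0[OF linear_K])
  next
    case False
    have "norm (K ((1 / norm x) *\<^sub>R x)) \<le> C" using False by (intro C) simp
    then show ?thesis using False by (simp add: linear_scale[OF linear_K] field_simps)
  qed
  then show ?thesis
    using linear_K unfolding bounded_linear_def bounded_linear_axioms_def by blast
qed

lemma eigenspace_D: "w \<in> eigenspace D A l \<Longrightarrow> w \<in> D"
  and eigenspace_A: "w \<in> eigenspace D A l \<Longrightarrow> A w = l *\<^sub>R w"
  by (simp_all add: eigenspace_def)

lemma subspace_eigenspace: "subspace (eigenspace D A l)"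
  unfolding subspace_def eigenspace_def
  using subspace_D A_scaleR[of 0 0]
  by (auto simp: A_add A_scaleR subspace_0 subspace_add subspace_scale scaleR_add_right scaleR_left_commute)

lemma eigenvalue_pos: "l \<in> eigenvalues D A \<Longrightarrow> l > 0"
proof -
  assume "l \<in> eigenvalues D A"
  then obtain w where w: "w \<in> D" "A w = l *\<^sub>R w" "w \<noteq> 0"
    by (auto simp: eigenvalues_def eigenspace_def)
  then have "l * (w \<bullet> w) > 0" using pd by (force simp: positive_definite_def)
  moreover have "w \<bullet> w > 0" using w by simp
  ultimately show "l > 0" by (simp add: zero_less_mult_iff)
qed

lemma eigenspace_iff_K:
  assumes "l > 0"
  shows "w \<in> eigenspace D A l \<longleftrightarrow> K w = (1 / l) *\<^sub>R w"
proof
  assume "w \<in> eigenspace D A l"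
  then have "w = l *\<^sub>R K w"
    by (metis K_A eigenspace_A eigenspace_D linear_K linear_scale)
  then have "(1 / l) *\<^sub>R w = (1 / l) *\<^sub>R l *\<^sub>R K w" by simp
  then show "K w = (1 / l) *\<^sub>R w" using assms by simp
next
  assume "K w = (1 / l) *\<^sub>R w"
  then have "w = l *\<^sub>R K w" using assms by simp
  then show "w \<in> eigenspace D A l"
    unfolding eigenspace_def
    by (metis (mono_tags, lifting) A_K A_scaleR K_in mem_Collect_eq subspace_D subspace_scale)
qed

lemma eigenspaces_orthogonal:
  assumes "v \<in> eigenspace D A l" "w \<in> eigenspace D A m" "l \<noteq> m"
  shows "v \<bullet> w = 0"
proof -
  have "l * (v \<bullet> w) = m * (v \<bullet> w)"
    using A_symmetric[of v w] assms by (simp add: eigenspace_def)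
  then show ?thesis using assms(3) by simp
qed

text \<open>On an eigenspace, \<open>K\<close> is multiplication by \<open>1 / l\<close>, so bounded parts of it are images under \<open>K\<close>
  of bounded sets.\<close>

lemma compact_eigenspace_Int_cball:
  assumes "l > 0"
  shows "compact (eigenspace D A l \<inter> cball v r)"
proof -
  let ?E = "eigenspace D A l \<inter> cball v r"
  have "?E = {w. K w = (1 / l) *\<^sub>R w} \<inter> cball v r"
    using eigenspace_iff_K[OF assms] by auto
  moreover have "closed {w. K w = (1 / l) *\<^sub>R w}"
    by (intro closed_Collect_eq linear_continuous_on bounded_linear_K bounded_linear_scaleR_right)
  ultimately have "closed ?E" by (simp add: closed_Int)
  moreover have "?E \<subseteq> closure (K ` cball (l *\<^sub>R v) (l * r))"
  proof
    fix w assume w: "w \<in> ?E"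
    then have "w = K (l *\<^sub>R w)"
      using assms eigenspace_iff_K[OF assms] by (simp add: linear_scale[OF linear_K])
    moreover have "l *\<^sub>R w \<in> cball (l *\<^sub>R v) (l * r)"
      using w assms by (simp add: dist_norm flip: scaleR_diff_right)
    ultimately show "w \<in> closure (K ` cball (l *\<^sub>R v) (l * r))"
      using closure_subset by (metis imageI subsetD)
  qed
  ultimately show ?thesis
    by (metis compact_K bounded_cball compact_Int_closed inf.absorb_iff2)
qed

abbreviation P :: "real \<Rightarrow> 'h \<Rightarrow> 'h" where
  "P l \<equiv> orth_proj (eigenspace D A l)"

lemma P_in: "l > 0 \<Longrightarrow> P l v \<in> eigenspace D A l"
  and P_orth: "l > 0 \<Longrightarrow> w \<in> eigenspace D A l \<Longrightarrow> (v - P l v) \<bullet> w = 0"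
proof -
  assume "l > 0"
  then obtain p where "p \<in> eigenspace D A l" "\<And>w. w \<in> eigenspace D A l \<Longrightarrow> (v - p) \<bullet> w = 0"
    using exists_orth_proj_of_compact[OF subspace_eigenspace compact_eigenspace_Int_cball] by blast
  moreover from this have "P l v = p" by (rule orth_proj_unique[OF subspace_eigenspace])
  ultimately show "P l v \<in> eigenspace D A l"
    and "w \<in> eigenspace D A l \<Longrightarrow> (v - P l v) \<bullet> w = 0" by simp_all
qed

lemma P_eqI: "p \<in> eigenspace D A l \<Longrightarrow> (\<And>w. w \<in> eigenspace D A l \<Longrightarrow> v \<bullet> w = p \<bullet> w) \<Longrightarrow> P l v = p"
  by (rule orth_proj_unique[OF subspace_eigenspace]) (simp_all add: inner_diff_left)

lemma P_inner: "l > 0 \<Longrightarrow> w \<in> eigenspace D A l \<Longrightarrow> P l v \<bullet> w = v \<bullet> w"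
  using P_orth[of l w v] by (simp add: inner_diff_left)

lemma P_self_inner: "l > 0 \<Longrightarrow> v \<bullet> P l v = (norm (P l v))\<^sup>2"
  using P_inner[OF _ P_in] by (metis power2_norm_eq_inner)

lemma bounded_linear_P:
  assumes "l > 0"
  shows "bounded_linear (P l)"
proof (rule bounded_linear_intro[where K = 1])
  note [simp] = P_inner[OF assms] P_in[OF assms]
  show "P l (x + y) = P l x + P l y" for x y
    by (rule P_eqI) (simp_all add: subspace_add[OF subspace_eigenspace] inner_add_left)
  show "P l (r *\<^sub>R x) = r *\<^sub>R P l x" for r x
    by (rule P_eqI) (simp_all add: subspace_scale[OF subspace_eigenspace])
  show "norm (P l x) \<le> norm x * 1" for x
  proof -
    have "norm (P l x) * norm (P l x) \<le> norm x * norm (P l x)"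
      using P_self_inner[OF assms, of x] norm_cauchy_schwarz[of x "P l x"] by (simp add: power2_eq_square)
    then show ?thesis by (cases "norm (P l x) = 0") (auto simp: mult_le_cancel_right)
  qed
qed

lemma P_eigenvector:
  "w \<in> eigenspace D A m \<Longrightarrow> P l w = (if l = m then w else 0)"
  using eigenspaces_orthogonal[of w m _ l]
  by (intro P_eqI) (auto simp: subspace_0[OF subspace_eigenspace])

lemma P_A:
  assumes "l > 0" "x \<in> D"
  shows "P l (A x) = l *\<^sub>R P l x"
proof (rule P_eqI)
  show "l *\<^sub>R P l x \<in> eigenspace D A l"
    by (simp add: P_in assms subspace_scale[OF subspace_eigenspace])
  show "A x \<bullet> w = (l *\<^sub>R P l x) \<bullet> w" if w: "w \<in> eigenspace D A l" for w
    using A_symmetric[OF assms(2) eigenspace_D[OF w]] by (simp add: eigenspace_A[OF w] P_inner[OF assms(1) w])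
qed

text \<open>The space \<open>W\<close> of all vectors orthogonal to every eigenvector is invariant under \<open>K\<close>. If it is
  nontrivial, \<open>K\<close> has an eigenvector in it, a contradiction. To find one, let \<open>\<mu>\<close> be the norm of
  \<open>K\<close> on \<open>W\<close>. By compactness some sequence of vectors \<open>u\<^sub>n\<close> in the unit ball of \<open>W\<close> has \<open>K u\<^sub>n\<close>
  converging to a vector \<open>c\<close> of norm \<open>\<mu>\<close>. Maximality forces \<open>K\<^sup>2 u\<^sub>n - \<mu>\<^sup>2 u\<^sub>n\<close> to tend to 0,
  and applying \<open>K\<close> gives \<open>K\<^sup>2 c = \<mu>\<^sup>2 c\<close>. Then \<open>K c + \<mu> c\<close> is an eigenvector of \<open>K\<close> for \<open>\<mu>\<close>; it is nonzero
  because \<open>K\<close> is positive.\<close>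

lemma eigenvectors_complete:
  assumes "\<And>l w. l \<in> eigenvalues D A \<Longrightarrow> w \<in> eigenspace D A l \<Longrightarrow> v \<bullet> w = 0"
  shows "v = 0"
proof (rule ccontr)
  assume "v \<noteq> 0"
  define W where "W = {v. \<forall>l\<in>eigenvalues D A. \<forall>w\<in>eigenspace D A l. v \<bullet> w = 0}"
  have v: "v \<in> W" using assms by (simp add: W_def)
  have subW: "subspace W"
    by (auto simp: subspace_def W_def inner_add_left)
  have "W = (\<Inter>l\<in>eigenvalues D A. \<Inter>w\<in>eigenspace D A l. {v. v \<bullet> w = 0})"
    by (auto simp: W_def)
  also have "closed \<dots>"
    by (intro closed_INT ballI closed_Collect_eq continuous_intros)
  finally have closedW: "closed W" .
  have KW: "K x \<in> W" if "x \<in> W" for x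
    using that eigenspace_iff_K eigenvalue_pos by (simp add: W_def K_symmetric)
  define B where "B = W \<inter> cball 0 1"
  have "compact (closure (K ` B))"
    by (rule compact_K) (simp add: B_def bounded_Int)
  moreover have "0 \<in> B" using subW by (simp add: B_def subspace_0)
  ultimately obtain c where c: "c \<in> closure (K ` B)"
      and max: "\<And>y. y \<in> closure (K ` B) \<Longrightarrow> norm y \<le> norm c"
    using continuous_attains_sup[of "closure (K ` B)" norm] continuous_on_norm_id by auto
  define \<mu> where "\<mu> = norm c"
  have le: "norm (K w) \<le> \<mu> * norm w" if w: "w \<in> W" for w
  proof (cases "w = 0")
    case False
    have "(1 / norm w) *\<^sub>R w \<in> B" using w subW by (simp add: B_def subspace_scale)
    then have "norm (K ((1 / norm w) *\<^sub>R w)) \<le> \<mu>"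
      unfolding \<mu>_def by (meson max closure_subset imageI subsetD)
    then show ?thesis using False by (simp add: linear_scale[OF linear_K] field_simps)
  qed (simp add: linear_0[OF linear_K])
  obtain u where u: "\<And>n. u n \<in> B" and lim: "(\<lambda>n. K (u n)) \<longlonglongrightarrow> c"
  proof -
    obtain x where x: "\<forall>n. x n \<in> K ` B" "x \<longlonglongrightarrow> c"
      using c unfolding closure_sequential by blast
    from x(1) have "\<forall>n. \<exists>b. b \<in> B \<and> x n = K b" by blast
    then obtain u where "\<And>n. u n \<in> B \<and> x n = K (u n)" by moura
    moreover from this have "x = (\<lambda>n. K (u n))" by auto
    ultimately show thesis using x(2) that by blast
  qed
  have uW: "u n \<in> W" and u1: "norm (u n) \<le> 1" for n
    using u by (simp_all add: B_def)
  have cW: "c \<in> W"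
    using closed_sequentially[OF closedW _ lim] KW uW by blast
  have "K v \<noteq> 0" using K_positive[OF \<open>v \<noteq> 0\<close>] by auto
  then have "0 < \<mu> * norm v" using le[OF v] by (meson le_less_trans norm_ge_zero order_less_le_trans zero_less_norm_iff)
  then have \<mu>: "\<mu> > 0" by (simp add: zero_less_mult_iff)
  have step: "(norm (K (K (u n)) - \<mu>\<^sup>2 *\<^sub>R u n))\<^sup>2 \<le> \<mu>\<^sup>2 * (\<mu>\<^sup>2 - (norm (K (u n)))\<^sup>2)" for n
  proof -
    have "(norm (K (K (u n)) - \<mu>\<^sup>2 *\<^sub>R u n))\<^sup>2
        = (norm (K (K (u n))))\<^sup>2 - 2 * \<mu>\<^sup>2 * (norm (K (u n)))\<^sup>2 + \<mu>^4 * (norm (u n))\<^sup>2"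
      unfolding power2_norm_eq_inner using K_symmetric[of "K (u n)" "u n"]
      by (simp add: inner_diff_left inner_diff_right inner_commute algebra_simps power2_eq_square power4_eq_xxxx)
    moreover have "(norm (K (K (u n))))\<^sup>2 \<le> \<mu>\<^sup>2 * (norm (K (u n)))\<^sup>2"
      using power_mono[OF le[OF KW[OF uW]] norm_ge_zero, of _ 2] by (simp add: power_mult_distrib)
    moreover have "\<mu>^4 * (norm (u n))\<^sup>2 \<le> \<mu>^4 * 1"
      using u1 by (intro mult_left_mono) (simp_all add: power_le_one)
    ultimately show ?thesis by (simp add: algebra_simps power2_eq_square power4_eq_xxxx)
  qed
  have "(\<lambda>n. \<mu>\<^sup>2 * (\<mu>\<^sup>2 - (norm (K (u n)))\<^sup>2)) \<longlonglongrightarrow> \<mu>\<^sup>2 * (\<mu>\<^sup>2 - (norm c)\<^sup>2)"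
    by (intro tendsto_intros lim)
  then have "(\<lambda>n. \<mu>\<^sup>2 * (\<mu>\<^sup>2 - (norm (K (u n)))\<^sup>2)) \<longlonglongrightarrow> 0"
    by (simp flip: \<mu>_def)
  then have "(\<lambda>n. (norm (K (K (u n)) - \<mu>\<^sup>2 *\<^sub>R u n))\<^sup>2) \<longlonglongrightarrow> 0"
    by (rule Lim_null_comparison[rotated]) (simp add: step)
  then have "(\<lambda>n. sqrt ((norm (K (K (u n)) - \<mu>\<^sup>2 *\<^sub>R u n))\<^sup>2)) \<longlonglongrightarrow> sqrt 0"
    by (rule tendsto_real_sqrt)
  then have "(\<lambda>n. K (K (u n)) - \<mu>\<^sup>2 *\<^sub>R u n) \<longlonglongrightarrow> 0"
    by (simp add: tendsto_norm_zero_iff)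
  then have "(\<lambda>n. K (K (K (u n)) - \<mu>\<^sup>2 *\<^sub>R u n)) \<longlonglongrightarrow> K 0"
    by (rule bounded_linear.tendsto[OF bounded_linear_K])
  then have "(\<lambda>n. K (K (K (u n))) - \<mu>\<^sup>2 *\<^sub>R K (u n)) \<longlonglongrightarrow> 0"
    by (simp add: linear_diff[OF linear_K] linear_scale[OF linear_K] linear_0[OF linear_K])
  moreover have "(\<lambda>n. K (K (K (u n))) - \<mu>\<^sup>2 *\<^sub>R K (u n)) \<longlonglongrightarrow> K (K c) - \<mu>\<^sup>2 *\<^sub>R c"
    by (intro tendsto_intros bounded_linear.tendsto[OF bounded_linear_K] lim)
  ultimately have KKc: "K (K c) = \<mu>\<^sup>2 *\<^sub>R c"
    using LIMSEQ_unique by fastforce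
  define y where "y = K c + \<mu> *\<^sub>R c"
  have "c \<noteq> 0" using \<mu> by (auto simp: \<mu>_def)
  then have "0 < K c \<bullet> c + \<mu> * (c \<bullet> c)"
    using K_positive \<mu> by (simp add: add_pos_pos)
  then have "y \<noteq> 0" by (auto simp: y_def inner_add_left[symmetric] simp flip: inner_scaleR_left)
  have "K y = \<mu> *\<^sub>R y"
    by (simp add: y_def linear_add[OF linear_K] linear_scale[OF linear_K] KKc scaleR_add_right power2_eq_square)
  then have y: "y \<in> eigenspace D A (1 / \<mu>)"
    using eigenspace_iff_K[of "1 / \<mu>" y] \<mu> by simp
  with \<open>y \<noteq> 0\<close> have "1 / \<mu> \<in> eigenvalues D A" by (auto simp: eigenvalues_def)
  moreover have "y \<in> W"
    unfolding y_def using cW KW subW by (simp add: subspace_add subspace_scale)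
  ultimately have "y \<bullet> y = 0" using y unfolding W_def by blast
  with \<open>y \<noteq> 0\<close> show False by simp
qed

lemma norm_sum_modes:
  assumes "finite F" "F \<subseteq> eigenvalues D A"
  shows "(norm (\<Sum>l\<in>F. \<phi> l *\<^sub>R P l v))\<^sup>2 = (\<Sum>l\<in>F. (\<phi> l)\<^sup>2 * (norm (P l v))\<^sup>2)"
proof -
  have "P l v \<in> eigenspace D A l" if "l \<in> F" for l
    using that assms P_in eigenvalue_pos by blast
  then have "pairwise (\<lambda>l m. orthogonal (\<phi> l *\<^sub>R P l v) (\<phi> m *\<^sub>R P m v)) F"
    unfolding pairwise_def orthogonal_def using eigenspaces_orthogonal by fastforce
  then show ?thesis
    using norm_sum_Pythagorean[OF assms(1), of "\<lambda>l. \<phi> l *\<^sub>R P l v"] by (simp add: power_mult_distrib)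
qed

lemma bessel:
  assumes "finite F" "F \<subseteq> eigenvalues D A"
  shows "(\<Sum>l\<in>F. (norm (P l v))\<^sup>2) \<le> (norm v)\<^sup>2"
proof -
  define s where "s = (\<Sum>l\<in>F. P l v)"
  have "(norm s)\<^sup>2 = (\<Sum>l\<in>F. (norm (P l v))\<^sup>2)"
    using norm_sum_modes[OF assms, of "\<lambda>_. 1" v] by (simp add: s_def)
  moreover have "v \<bullet> s = (\<Sum>l\<in>F. (norm (P l v))\<^sup>2)"
    unfolding s_def inner_sum_right using assms eigenvalue_pos
    by (intro sum.cong) (auto intro: P_self_inner)
  moreover have "0 \<le> (norm v)\<^sup>2 - 2 * (v \<bullet> s) + (norm s)\<^sup>2"
    using zero_le_power2[of "norm (v - s)"] unfolding power2_norm_eq_inner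
    by (simp add: inner_diff_left inner_diff_right inner_commute algebra_simps)
  ultimately show ?thesis by simp
qed

lemma L2_set_modes_le:
  assumes "finite F" "F \<subseteq> eigenvalues D A"
  shows "L2_set (\<lambda>l. norm (P l v)) F \<le> norm v"
  unfolding L2_set_def using bessel[OF assms, of v] by (simp add: real_le_lsqrt)

lemma op_fun_has_sum:
  assumes "\<And>l. l \<in> eigenvalues D A \<Longrightarrow> \<bar>\<phi> l\<bar> \<le> B"
  shows "((\<lambda>l. \<phi> l *\<^sub>R P l v) has_sum op_fun D A \<phi> v) (eigenvalues D A)"
proof -
  let ?E = "eigenvalues D A"
  let ?q = "\<lambda>l. (norm (\<phi> l *\<^sub>R P l v))\<^sup>2"
  have "sum ?q F \<le> B\<^sup>2 * (norm v)\<^sup>2" if "finite F" "F \<subseteq> ?E" for F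
  proof -
    have "sum ?q F \<le> (\<Sum>l\<in>F. B\<^sup>2 * (norm (P l v))\<^sup>2)"
    proof (rule sum_mono)
      fix l assume "l \<in> F"
      then have "\<bar>\<phi> l\<bar>\<^sup>2 \<le> B\<^sup>2" using assms that by (intro power_mono) auto
      then show "?q l \<le> B\<^sup>2 * (norm (P l v))\<^sup>2"
        by (simp add: power_mult_distrib mult_right_mono)
    qed
    also have "\<dots> \<le> B\<^sup>2 * (norm v)\<^sup>2"
      unfolding sum_distrib_left[symmetric] by (intro mult_left_mono bessel that) simp
    finally show ?thesis .
  qed
  then have "?q summable_on ?E"
    by (intro nonneg_bdd_above_summable_on bdd_aboveI[where M = "B\<^sup>2 * (norm v)\<^sup>2"]) auto
  then have "(\<lambda>l. \<phi> l *\<^sub>R P l v) summable_on ?E"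
  proof (rule orthogonal_summable_on[rotated])
    show "pairwise (\<lambda>l m. orthogonal (\<phi> l *\<^sub>R P l v) (\<phi> m *\<^sub>R P m v)) ?E"
      unfolding pairwise_def orthogonal_def
      using eigenspaces_orthogonal[OF P_in P_in] eigenvalue_pos by simp
  qed
  then show ?thesis by (simp add: op_fun_def has_sum_infsum)
qed

lemma P_op_fun:
  assumes "\<And>l. l \<in> eigenvalues D A \<Longrightarrow> \<bar>\<phi> l\<bar> \<le> B" and m: "m \<in> eigenvalues D A"
  shows "P m (op_fun D A \<phi> v) = \<phi> m *\<^sub>R P m v"
proof -
  have blP: "bounded_linear (P m)" using bounded_linear_P eigenvalue_pos[OF m] by blast
  have "((\<lambda>l. P m (\<phi> l *\<^sub>R P l v)) has_sum P m (op_fun D A \<phi> v)) (eigenvalues D A)"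
    by (rule has_sum_bounded_linear[OF blP op_fun_has_sum[OF assms(1)]])
  moreover have "((\<lambda>l. P m (\<phi> l *\<^sub>R P l v)) has_sum \<phi> m *\<^sub>R P m v) (eigenvalues D A)"
  proof (rule has_sum_finite_neutralI[where B = "{m}"])
    show "P m (\<phi> l *\<^sub>R P l v) = 0" if "l \<in> eigenvalues D A - {m}" for l
      using that P_eigenvector[OF P_in[OF eigenvalue_pos], where l = m]
      by (simp add: linear_scale[OF bounded_linear.linear[OF blP]])
    show "\<phi> m *\<^sub>R P m v = (\<Sum>l\<in>{m}. P m (\<phi> l *\<^sub>R P l v))"
      using P_eigenvector[OF P_in[OF eigenvalue_pos[OF m]], where l = m]
      by (simp add: linear_scale[OF bounded_linear.linear[OF blP]])
  qed (use m in auto)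
  ultimately show ?thesis by (rule has_sum_unique)
qed

lemma modes_determine:
  assumes "\<And>l. l \<in> eigenvalues D A \<Longrightarrow> P l x = P l y"
  shows "x = y"
proof -
  have "(x - y) \<bullet> w = 0" if l: "l \<in> eigenvalues D A" and w: "w \<in> eigenspace D A l" for l w
    using P_inner[OF eigenvalue_pos[OF l] w, of x] P_inner[OF eigenvalue_pos[OF l] w, of y]
      assms[OF l] by (simp add: inner_diff_left)
  then have "x - y = 0" by (rule eigenvectors_complete)
  then show ?thesis by simp
qed

text \<open>By completeness \<open>v\<close> is the limit of the finite partial sums of its eigenvector expansion, so a bound on
  finitely many modes at a time suffices. This keeps the later estimates free of infinite sums.\<close>

lemma norm_le_of_modes:
  assumes "\<And>F. finite F \<Longrightarrow> F \<subseteq> eigenvalues D A \<Longrightarrow> L2_set (\<lambda>l. norm (P l v)) F \<le> C"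
  shows "norm v \<le> C"
proof -
  have "op_fun D A (\<lambda>_. 1) v = v"
    by (rule modes_determine) (simp add: P_op_fun[where B = 1])
  then have "((\<lambda>l. P l v) has_sum v) (eigenvalues D A)"
    using op_fun_has_sum[of "\<lambda>_. 1" 1 v] by simp
  then have "((\<lambda>F. norm (\<Sum>l\<in>F. P l v)) \<longlongrightarrow> norm v) (finite_subsets_at_top (eigenvalues D A))"
    unfolding has_sum_def by (rule tendsto_norm)
  moreover have "norm (\<Sum>l\<in>F. P l v) \<le> C" if F: "finite F" "F \<subseteq> eigenvalues D A" for F
  proof -
    have "norm (\<Sum>l\<in>F. P l v) = L2_set (\<lambda>l. norm (P l v)) F"
      using norm_sum_modes[OF F, of "\<lambda>_. 1" v] by (simp add: L2_set_def real_sqrt_unique)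
    with assms[OF F] show ?thesis by simp
  qed
  then have "\<forall>\<^sub>F F in finite_subsets_at_top (eigenvalues D A). norm (\<Sum>l\<in>F. P l v) \<le> C"
    by (intro eventually_finite_subsets_at_top_weakI) blast
  ultimately show ?thesis
    using tendsto_upperbound finite_subsets_at_top_neq_bot by blast
qed

text \<open>The propagator is defined by an arbitrary choice of a preimage under \<open>I + \<tau> A\<close>, so the range of this
  operator must be shown to contain \<open>w = v + \<tau> f(t)\<close>. A solution is \<open>K y\<close>, where \<open>y = A (I + \<tau> A)\<^sup>-\<^sup>1 w\<close> is
  given by a bounded function of \<open>A\<close>; summing the expansion of \<open>y\<close> and applying \<open>K\<close> afterwards is what
  places the solution in the domain of \<open>A\<close>. Comparing components then applies to whichever
  preimage was chosen.\<close>

lemma P_coarse_prop: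
  assumes "\<tau> > 0" and l: "l \<in> eigenvalues D A"
  shows "P l (coarse_prop D A t \<tau> v f) = (1 / (1 + \<tau> * l)) *\<^sub>R (P l v + \<tau> *\<^sub>R P l (f t))"
proof -
  define w where "w = v + \<tau> *\<^sub>R f t"
  define x where "x = coarse_prop D A t \<tau> v f"
  have lin: "linear (P m)" if "m \<in> eigenvalues D A" for m
    using bounded_linear_P eigenvalue_pos[OF that] by (blast intro: bounded_linear.linear)
  define y where "y = op_fun D A (\<lambda>m. m / (1 + \<tau> * m)) w"
  have "P m (K y + \<tau> *\<^sub>R A (K y)) = P m w" if m: "m \<in> eigenvalues D A" for m
  proof -
    have m0: "m > 0" by (rule eigenvalue_pos[OF m])
    have "\<bar>k / (1 + \<tau> * k)\<bar> \<le> 1 / \<tau>" if "k \<in> eigenvalues D A" for k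
    proof -
      have "k > 0" "1 + \<tau> * k > 0"
        using eigenvalue_pos[OF that] assms(1) by (simp_all add: add_pos_pos)
      moreover from this have "k / (1 + \<tau> * k) \<le> 1 / \<tau>"
        unfolding pos_divide_le_eq[OF \<open>1 + \<tau> * k > 0\<close>] using assms(1) by (simp add: distrib_left)
      ultimately show ?thesis by simp
    qed
    then have Py: "P m y = (m / (1 + \<tau> * m)) *\<^sub>R P m w"
      unfolding y_def by (rule P_op_fun[OF _ m])
    have "m *\<^sub>R P m (K y) = P m y"
      using P_A[OF m0 K_in[of y]] by (simp add: A_K)
    then have "m *\<^sub>R P m (K y + \<tau> *\<^sub>R A (K y)) = (1 + \<tau> * m) *\<^sub>R P m y"
      by (simp add: A_K linear_add[OF lin[OF m]] linear_scale[OF lin[OF m]] scaleR_add_right scaleR_add_left mult.commute)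
    also have "\<dots> = m *\<^sub>R P m w"
    proof -
      have "1 + \<tau> * m \<noteq> 0" using m0 assms(1) by (simp add: add_pos_pos order_less_imp_not_eq2)
      then show ?thesis by (simp add: Py)
    qed
    finally show ?thesis using m0 by simp
  qed
  then have "K y + \<tau> *\<^sub>R A (K y) = w" by (rule modes_determine)
  then have "w \<in> (\<lambda>x. x + \<tau> *\<^sub>R A x) ` D" using K_in by blast
  then have xD: "x \<in> D" and x: "x + \<tau> *\<^sub>R A x = w"
    unfolding x_def coarse_prop_def w_def[symmetric]
    by (rule inv_into_into, rule f_inv_into_f)
  have "(1 + \<tau> * l) *\<^sub>R P l x = P l w"
    unfolding x[symmetric] using P_A[OF eigenvalue_pos[OF l] xD]
    by (simp add: linear_add[OF lin[OF l]] linear_scale[OF lin[OF l]] algebra_simps)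
  then have "(1 / (1 + \<tau> * l)) *\<^sub>R (1 + \<tau> * l) *\<^sub>R P l x = (1 / (1 + \<tau> * l)) *\<^sub>R P l w" by simp
  moreover have "1 + \<tau> * l > 0" using assms(1) eigenvalue_pos[OF l] by (simp add: add_pos_pos)
  ultimately show ?thesis
    by (simp add: x_def w_def linear_add[OF lin[OF l]] linear_scale[OF lin[OF l]])
qed

end

section \<open>Convergence of the parareal iteration\<close>

lemma L2_set_sum_le:
  "L2_set (\<lambda>l. \<Sum>j\<in>S. h j l) F \<le> (\<Sum>j\<in>S. L2_set (h j) F)"
proof (induction S rule: infinite_finite_induct)
  case (insert j S)
  then show ?case
    using L2_set_triangle_ineq[of "h j" "\<lambda>l. \<Sum>j\<in>S. h j l" F] by simp
qed (simp_all add: L2_set_def)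

lemma lobatto_c_bounds: "0 \<le> lobatto_c $ i" "lobatto_c $ i \<le> 1"
proof -
  have "0 \<le> sqrt 5" "sqrt 5 \<le> 5" by (simp_all add: real_le_lsqrt)
  then have "\<forall>i. 0 \<le> lobatto_c $ i \<and> lobatto_c $ i \<le> 1"
    unfolding forall_4 lobatto_c_def vector_4 by (simp add: field_simps)
  then show "0 \<le> lobatto_c $ i" "lobatto_c $ i \<le> 1" by blast+
qed

lemma single_step_Suc:
  "single_step D A f u0 dt (Suc n) = fine_prop D A (real n * dt) dt (single_step D A f u0 dt n) f"
  by (simp add: fine_prop_def)

lemma fine_sweep_single_step:
  "fine_sweep D A f (real n * (real J * dt)) dt (single_step D A f u0 dt (n * J)) j =
   single_step D A f u0 dt (n * J + j)"
proof (induction j)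
  case (Suc j)
  have "real n * (real J * dt) + real j * dt = real (n * J + j) * dt"
    by (simp add: algebra_simps)
  then show ?case
    unfolding add_Suc_right single_step_Suc fine_sweep.simps Suc.IH by simp
qed simp

context positive_operator_with_compact_inverse
begin

lemma P_linear:
  assumes "l \<in> eigenvalues D A"
  shows "P l (x + y) = P l x + P l y" "P l (x - y) = P l x - P l y"
    "P l (a *\<^sub>R x) = a *\<^sub>R P l x" "P l (sum h S) = (\<Sum>i\<in>S. P l (h i))"
proof -
  have "linear (P l)"
    using bounded_linear_P[OF eigenvalue_pos[OF assms]] by (rule bounded_linear.linear)
  then show "P l (x + y) = P l x + P l y" "P l (x - y) = P l x - P l y"
    "P l (a *\<^sub>R x) = a *\<^sub>R P l x" "P l (sum h S) = (\<Sum>i\<in>S. P l (h i))"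
    by (simp_all add: linear_add linear_diff linear_scale linear_sum)
qed

lemma P_fine_prop:
  assumes "dt > 0" and l: "l \<in> eigenvalues D A"
  shows "P l (fine_prop D A t dt v f) = lobatto_r (- (dt * l)) *\<^sub>R P l v
    + dt *\<^sub>R (\<Sum>i\<in>UNIV. lobatto_p i (- (dt * l)) *\<^sub>R P l (f (t + lobatto_c $ i * dt)))"
proof -
  have s: "0 \<le> dt * m" if "m \<in> eigenvalues D A" for m
    using assms(1) eigenvalue_pos[OF that] by simp
  have "P l (op_fun D A (\<lambda>m. lobatto_r (- (dt * m))) w) = lobatto_r (- (dt * l)) *\<^sub>R P l w" for w
    using lobatto_r_bounds[OF s] by (intro P_op_fun[where B = 1] l) (simp add: abs_le_iff order_trans[of "-1" 0])
  moreover have "P l (op_fun D A (\<lambda>m. lobatto_p i (- (dt * m))) w) = lobatto_p i (- (dt * l)) *\<^sub>R P l w" for i w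
    using lobatto_p_bounded[OF s] by (intro P_op_fun[where B = 1] l)
  ultimately show ?thesis
    by (simp add: fine_prop_def P_linear[OF l])
qed

lemma P_fine_sweep_diff:
  assumes "dt > 0" and l: "l \<in> eigenvalues D A"
  shows "P l (fine_sweep D A f t dt v j) - P l (fine_sweep D A f t dt w j)
    = lobatto_r (- (dt * l)) ^ j *\<^sub>R (P l v - P l w)"
proof (induction j)
  case (Suc j)
  have "P l (fine_sweep D A f t dt v (Suc j)) - P l (fine_sweep D A f t dt w (Suc j))
    = lobatto_r (- (dt * l)) *\<^sub>R (P l (fine_sweep D A f t dt v j) - P l (fine_sweep D A f t dt w j))"
    by (simp add: P_fine_prop[OF assms] scaleR_diff_right)
  then show ?case by (simp add: Suc.IH)
qed simp

text \<open>Over one coarse step the error components obey the recursion with \<open>g\<close> and \<open>R - g\<close>. The induction on \<open>n\<close>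
  closes because \<open>g\<close> and the contraction bound \<open>\<gamma> (1 - g)\<close> combine to
  \<open>g \<gamma> + \<gamma> (1 - g) = \<gamma>\<close>, with \<open>\<gamma> = 0.31\<close>.\<close>

lemma parareal_mode_error:
  assumes dt: "dt > 0" and J: "J > 0" and l: "l \<in> eigenvalues D A"
    and init: "\<And>n. n \<le> N \<Longrightarrow> norm (P l (parareal D A f u0 dt J 0 n) - P l (single_step D A f u0 dt (n * J))) \<le> m"
    and "n \<le> N"
  shows "norm (P l (parareal D A f u0 dt J k n) - P l (single_step D A f u0 dt (n * J))) \<le> 0.31 ^ k * m"
  using \<open>n \<le> N\<close>
proof (induction k arbitrary: n)
  case 0
  then show ?case using init by simp
next
  case (Suc k)
  let ?U = "\<lambda>k n. P l (parareal D A f u0 dt J k n)"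
  let ?u = "\<lambda>n. P l (single_step D A f u0 dt (n * J))"
  define g where "g = 1 / (1 + real J * (dt * l))"
  define R where "R = lobatto_r (- (dt * l)) ^ J"
  have s: "dt * l > 0" using dt eigenvalue_pos[OF l] by simp
  have "1 + real J * (dt * l) \<ge> 1" using s by simp
  then have g: "0 \<le> g" "g \<le> 1" unfolding g_def by (simp_all add: divide_le_eq)
  have R: "\<bar>R - g\<bar> \<le> 0.31 * (1 - g)"
    unfolding R_def g_def by (rule parareal_mode_contraction) (use s in simp)
  have m: "0 \<le> 0.31 ^ k * m"
    using Suc.IH[of 0] by simp
  show ?case using \<open>n \<le> N\<close>
  proof (induction n)
    case 0
    show ?case using m by (simp add: mult.commute)
  next
    case (Suc n)
    have dT: "real J * dt > 0" using dt J by simp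
    have G: "P l (coarse_prop D A t (real J * dt) v f) = g *\<^sub>R (P l v + (real J * dt) *\<^sub>R P l (f t))" for t v
      using P_coarse_prop[OF dT l] by (simp add: g_def mult.assoc)
    have u: "?u (Suc n) = P l (fine_sweep D A f (real n * (real J * dt)) dt (single_step D A f u0 dt (n * J)) J)"
      by (simp add: fine_sweep_single_step add.commute)
    have "?U (Suc k) (Suc n) - ?u (Suc n)
      = g *\<^sub>R (?U (Suc k) n - ?U k n) + R *\<^sub>R (?U k n - ?u n)"
      unfolding u R_def P_fine_sweep_diff[OF dt l, where f = f and t = "real n * (real J * dt)", symmetric]
      by (simp add: Let_def P_linear[OF l] G) (simp add: algebra_simps)
    also have "\<dots> = g *\<^sub>R (?U (Suc k) n - ?u n) + (R - g) *\<^sub>R (?U k n - ?u n)"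
      by (simp add: algebra_simps)
    finally have "norm (?U (Suc k) (Suc n) - ?u (Suc n))
        \<le> g * norm (?U (Suc k) n - ?u n) + \<bar>R - g\<bar> * norm (?U k n - ?u n)"
      using norm_triangle_ineq[of "g *\<^sub>R (?U (Suc k) n - ?u n)" "(R - g) *\<^sub>R (?U k n - ?u n)"] g by simp
    also have "\<dots> \<le> g * (0.31 ^ Suc k * m) + 0.31 * (1 - g) * (0.31 ^ k * m)"
      using Suc g R m by (intro add_mono mult_mono mult_left_mono Suc.IH \<open>\<And>n. n \<le> N \<Longrightarrow> norm (?U k n - ?u n) \<le> 0.31 ^ k * m\<close>) simp_all
    also have "\<dots> = 0.31 ^ Suc k * m" by (simp add: field_simps)
    finally show ?case .
  qed
qed

lemma P_single_step_bound:
  assumes "dt > 0" and l: "l \<in> eigenvalues D A"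
  shows "norm (P l (single_step D A f u0 dt n)) \<le> norm (P l u0)
    + dt * (\<Sum>j<n. \<Sum>i\<in>UNIV. norm (P l (f (real j * dt + lobatto_c $ i * dt))))"
proof (induction n)
  case (Suc n)
  have s: "0 \<le> dt * l" using assms(1) eigenvalue_pos[OF l] by simp
  let ?F = "\<lambda>i. P l (f (real n * dt + lobatto_c $ i * dt))"
  have "norm (P l (single_step D A f u0 dt (Suc n)))
    \<le> \<bar>lobatto_r (- (dt * l))\<bar> * norm (P l (single_step D A f u0 dt n))
      + dt * norm (\<Sum>i\<in>UNIV. lobatto_p i (- (dt * l)) *\<^sub>R ?F i)"
    unfolding single_step_Suc P_fine_prop[OF assms]
    by (rule order_trans[OF norm_triangle_ineq]) (use assms(1) in simp)
  also have "\<dots> \<le> 1 * norm (P l (single_step D A f u0 dt n)) + dt * (\<Sum>i\<in>UNIV. norm (?F i))"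
  proof (intro add_mono mult_right_mono mult_left_mono)
    show "norm (\<Sum>i\<in>UNIV. lobatto_p i (- (dt * l)) *\<^sub>R ?F i) \<le> (\<Sum>i\<in>UNIV. norm (?F i))"
    proof (rule sum_norm_le)
      show "norm (lobatto_p i (- (dt * l)) *\<^sub>R ?F i) \<le> norm (?F i)" for i
        using mult_right_mono[OF lobatto_p_bounded[OF s, of i] norm_ge_zero[of "?F i"]] by simp
    qed
  qed (use lobatto_r_bounds[OF s] assms(1) in auto)
  finally show ?case using Suc.IH by (simp add: distrib_left)
qed simp

lemma P_coarse_bound:
  assumes "J > 0" "dt > 0" and l: "l \<in> eigenvalues D A"
  shows "norm (P l (parareal D A f u0 dt J 0 n)) \<le> norm (P l u0)
    + real J * dt * (\<Sum>j<n. norm (P l (f (real j * (real J * dt)))))"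
proof (induction n)
  case (Suc n)
  have dT: "real J * dt > 0" using assms by simp
  let ?v = "P l (parareal D A f u0 dt J 0 n) + (real J * dt) *\<^sub>R P l (f (real n * (real J * dt)))"
  have "norm (P l (parareal D A f u0 dt J 0 (Suc n))) = norm ?v / (1 + real J * dt * l)"
    using dT eigenvalue_pos[OF l] by (simp add: Let_def P_coarse_prop[OF dT l])
  also have "\<dots> \<le> norm ?v / 1"
    using dT eigenvalue_pos[OF l] by (intro divide_left_mono) (simp_all add: add_pos_pos)
  also have "\<dots> \<le> norm (P l (parareal D A f u0 dt J 0 n))
      + real J * dt * norm (P l (f (real n * (real J * dt))))"
    using norm_triangle_ineq[of "P l (parareal D A f u0 dt J 0 n)" "(real J * dt) *\<^sub>R P l (f (real n * (real J * dt)))"] dT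
    by simp
  finally show ?case using Suc.IH by (simp add: distrib_left)
qed simp

text \<open>The majorant \<open>a + (b + c)\<close> of the initial error on each mode does not depend on \<open>n\<close>. It collects \<open>u\<^sup>0\<close>
  once for each of the two propagators, the coarse quadrature of \<open>f\<close> of total weight \<open>T\<close>, and the fine
  one with four stages of total weight \<open>4 T\<close>, which explains the constant.\<close>

theorem parareal_error_bound:
  assumes dt: "dt > 0" and J: "J > 0" and n: "n \<le> Nc"
    and T: "real (J * Nc) * dt = T"
    and M: "\<And>t. 0 \<le> t \<Longrightarrow> t \<le> T \<Longrightarrow> norm (f t) \<le> M"
  shows "norm (parareal D A f u0 dt J k n - single_step D A f u0 dt (n * J))
    \<le> (2 * norm u0 + 5 * T * M) * 0.31 ^ k"
proof (rule norm_le_of_modes)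
  fix F assume F: "finite F" "F \<subseteq> eigenvalues D A"
  define a where "a l = norm (P l u0) + norm (P l u0)" for l
  define b where "b l = real J * dt * (\<Sum>j<Nc. norm (P l (f (real j * (real J * dt)))))" for l
  define c where "c l = dt * (\<Sum>j<Nc * J. \<Sum>i\<in>UNIV. norm (P l (f (real j * dt + lobatto_c $ i * dt))))" for l
  have mode: "norm (P l (parareal D A f u0 dt J k n - single_step D A f u0 dt (n * J)))
      \<le> 0.31 ^ k * (a l + (b l + c l))" if "l \<in> F" for l
  proof -
    have l: "l \<in> eigenvalues D A" using that F by blast
    have "norm (P l (parareal D A f u0 dt J 0 n) - P l (single_step D A f u0 dt (n * J))) \<le> a l + (b l + c l)"
      if "n \<le> Nc" for n
    proof -
      have "(\<Sum>j<n. norm (P l (f (real j * (real J * dt))))) \<le> (\<Sum>j<Nc. norm (P l (f (real j * (real J * dt)))))"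
        using that by (intro sum_mono2) auto
      then have "norm (P l (parareal D A f u0 dt J 0 n)) \<le> norm (P l u0) + b l"
        using P_coarse_bound[OF J dt l, of f u0 n] dt J unfolding b_def
        by (meson add_left_mono mult_left_mono order_trans of_nat_0_le_iff less_imp_le mult_nonneg_nonneg)
      moreover have "n * J \<le> Nc * J" using that by simp
      then have "(\<Sum>j<n * J. \<Sum>i\<in>UNIV. norm (P l (f (real j * dt + lobatto_c $ i * dt))))
          \<le> (\<Sum>j<Nc * J. \<Sum>i\<in>UNIV. norm (P l (f (real j * dt + lobatto_c $ i * dt))))"
        by (intro sum_mono2) (auto intro: sum_nonneg)
      then have "norm (P l (single_step D A f u0 dt (n * J))) \<le> norm (P l u0) + c l"
        using P_single_step_bound[OF dt l, of f u0 "n * J"] dt unfolding c_def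
        by (meson add_left_mono mult_left_mono order_trans less_imp_le)
      ultimately show ?thesis
        using norm_triangle_ineq4[of "P l (parareal D A f u0 dt J 0 n)" "P l (single_step D A f u0 dt (n * J))"]
        by (simp add: a_def)
    qed
    from parareal_mode_error[OF dt J l this n] show ?thesis by (simp add: P_linear[OF l])
  qed
  have modes: "L2_set (\<lambda>l. norm (P l v)) F \<le> norm v" for v
    by (rule L2_set_modes_le[OF F])
  have "L2_set a F \<le> 2 * norm u0"
    unfolding a_def using L2_set_triangle_ineq[of "\<lambda>l. norm (P l u0)" "\<lambda>l. norm (P l u0)" F] modes[of u0] by simp
  have "L2_set b F = real J * dt * L2_set (\<lambda>l. \<Sum>j<Nc. norm (P l (f (real j * (real J * dt))))) F"
    unfolding b_def using dt by (simp add: L2_set_right_distrib)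
  also have "\<dots> \<le> real J * dt * (\<Sum>j<Nc. M)"
  proof (intro mult_left_mono order_trans[OF L2_set_sum_le] sum_mono order_trans[OF modes] M)
    fix j assume "j \<in> {..<Nc}"
    then show "real j * (real J * dt) \<le> T"
      using dt mult_right_mono[of "real j" "real Nc" "real J * dt"] by (simp flip: T add: mult_ac)
  qed (use dt in simp_all)
  also have "\<dots> = T * M" by (simp flip: T)
  finally have "L2_set b F \<le> T * M" .
  have "L2_set c F = dt * L2_set (\<lambda>l. \<Sum>j<Nc * J. \<Sum>i\<in>UNIV. norm (P l (f (real j * dt + lobatto_c $ i * dt)))) F"
    unfolding c_def using dt by (simp add: L2_set_right_distrib)
  also have "\<dots> \<le> dt * (\<Sum>j<Nc * J. \<Sum>i\<in>(UNIV :: 4 set). M)"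
  proof (intro mult_left_mono order_trans[OF L2_set_sum_le] sum_mono order_trans[OF modes] M)
    fix j i assume "j \<in> {..<Nc * J}"
    then have "real j + 1 \<le> real (J * Nc)" by (simp add: mult.commute flip: of_nat_Suc of_nat_mult)
    then have "(real j + lobatto_c $ i) * dt \<le> T"
      unfolding T[symmetric] using lobatto_c_bounds(2)[of i] dt by (intro mult_right_mono) simp_all
    then show "real j * dt + lobatto_c $ i * dt \<le> T" by (simp add: distrib_right)
    show "0 \<le> real j * dt + lobatto_c $ i * dt" using dt lobatto_c_bounds(1)[of i] by simp
  qed (use dt in simp_all)
  also have "\<dots> = 4 * T * M" by (simp flip: T)
  finally have "L2_set c F \<le> 4 * T * M" .
  have "L2_set (\<lambda>l. norm (P l (parareal D A f u0 dt J k n - single_step D A f u0 dt (n * J)))) F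
    \<le> L2_set (\<lambda>l. 0.31 ^ k * (a l + (b l + c l))) F"
    by (rule L2_set_mono) (use mode in auto)
  also have "\<dots> = 0.31 ^ k * L2_set (\<lambda>l. a l + (b l + c l)) F"
    by (simp add: L2_set_right_distrib)
  also have "\<dots> \<le> 0.31 ^ k * (L2_set a F + (L2_set b F + L2_set c F))"
    by (intro mult_left_mono order_trans[OF L2_set_triangle_ineq] add_left_mono L2_set_triangle_ineq) simp
  also have "\<dots> \<le> 0.31 ^ k * (2 * norm u0 + (T * M + 4 * T * M))"
    by (intro mult_left_mono add_mono) (fact | simp)+
  finally show "L2_set (\<lambda>l. norm (P l (parareal D A f u0 dt J k n - single_step D A f u0 dt (n * J)))) F
    \<le> (2 * norm u0 + 5 * T * M) * 0.31 ^ k" by (simp add: algebra_simps)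
qed

end

theorem proposition4p4:
  fixes D :: "'h::{real_inner, complete_space} set" and A :: "'h \<Rightarrow> 'h"
    and f :: "real \<Rightarrow> 'h" and u0 :: 'h and T :: real
  assumes "linear_operator D A" and "closure D = UNIV"
    and "selfadjoint D A" and "positive_definite D A" and "compact_inverse D A"
    and "T > 0" and "continuous_on {0..T} f"
  shows "\<exists>c::real. \<forall>J\<ge>2. \<forall>Nc\<ge>1. \<forall>k::nat.
    (let dt = T / real (J * Nc)
     in (MAX n\<in>{1..Nc}. norm (parareal D A f u0 dt J k n - single_step D A f u0 dt (n * J)))
          \<le> c * 0.31 ^ k)"
proof -
  interpret positive_operator_with_compact_inverse D A
    using assms by unfold_locales
  have "bounded (f ` {0..T})"
    using assms(7) by (intro compact_imp_bounded compact_continuous_image) simp_all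
  then obtain M where M: "\<And>t. t \<in> {0..T} \<Longrightarrow> norm (f t) \<le> M"
    unfolding bounded_iff by blast
  show ?thesis
  proof (intro exI allI impI)
    fix J Nc k :: nat assume J: "2 \<le> J" and Nc: "1 \<le> Nc"
    define dt where "dt = T / real (J * Nc)"
    have "dt > 0" "real (J * Nc) * dt = T"
      using J Nc \<open>T > 0\<close> by (simp_all add: dt_def)
    then have "norm (parareal D A f u0 dt J k n - single_step D A f u0 dt (n * J))
        \<le> (2 * norm u0 + 5 * T * M) * 0.31 ^ k" if "n \<in> {1..Nc}" for n
      using J M that by (intro parareal_error_bound[where Nc = Nc]) simp_all
    then have "(MAX n\<in>{1..Nc}. norm (parareal D A f u0 dt J k n - single_step D A f u0 dt (n * J)))
        \<le> (2 * norm u0 + 5 * T * M) * 0.31 ^ k"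
      using Nc by (subst Max_le_iff) auto
    then show "let dt = T / real (J * Nc)
       in (MAX n\<in>{1..Nc}. norm (parareal D A f u0 dt J k n - single_step D A f u0 dt (n * J)))
            \<le> (2 * norm u0 + 5 * T * M) * 0.31 ^ k"
      unfolding Let_def dt_def .
  qed
qed

end
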